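(* Suppose choices follow the Luce choice model with true parameter $\theta^\star\in\Theta_b$, all (fixed) comparison sets $S_1,\dots,S_m$ have cardinality $k\ge2$, and $\lambda_2(L_M)>0$. Let $\widehat\theta\in\arg\max_{\theta\in\Theta_b}\ell(\theta)$. Then with probability at least $1-2/n$, $$\mathrm{MSE}(\widehat\theta,\theta^\star)\le D^2\,\frac{n(\log n+2)}{\lambda_2(L_M)^2}\,\frac1m,\qquad D=4k^2e^{4b}.$$
   Context: Items $N=\{1,\dots,n\}$; observations $(S_t,y_t)$, $t=1,\dots,m$, $y_t\in S_t\subseteq N$. Luce choice model: given the comparison sets, the choices are independent with $\Pr[y_t=i]=p_{i,S_t}(\theta^\star)$, where $p_{i,S}(\theta)=e^{\theta_i}/\sum_{v\in S}e^{\theta_v}$. Log-likelihood $\ell(\theta)=\sum_{t=1}^m\log p_{y_t,S_t}(\theta)$. $\Theta_b=\{\theta\in[-b,b]^n:\sum_i\theta_i=0\}$, $\mathrm{MSE}(\widehat\theta,\theta^\star)=\frac1n\|\widehat\theta-\theta^\star\|_2^2$. $M\in\mathbb R^{n\times n}$ has zero diagonal and off-diagonal entries $\frac nm\cdot\#\{t:\{i,j\}\subseteq S_t\}$. Laplacian $L_A=\mathrm{diag}(A\mathbf 1)-A$; $\lambda_2$ is the second smallest eigenvalue. *)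

theory Defs
  imports "HOL-Probability.Probability" "Jordan_Normal_Form.Char_Poly"
begin

text \<open>Items are 0..<n, observations are indexed by t < m. Parameter vectors are
  functions nat => real, extensional (zero outside the item set).\<close>

definition luce_prob :: "(nat \<Rightarrow> real) \<Rightarrow> nat set \<Rightarrow> nat \<Rightarrow> real" where
  "luce_prob \<theta> S i = exp (\<theta> i) / (\<Sum>v\<in>S. exp (\<theta> v))"

definition luce_pmf :: "(nat \<Rightarrow> real) \<Rightarrow> nat set \<Rightarrow> nat pmf" where
  "luce_pmf \<theta> S = embed_pmf (\<lambda>i. if i \<in> S then luce_prob \<theta> S i else 0)"

definition choices_pmf :: "(nat \<Rightarrow> real) \<Rightarrow> nat \<Rightarrow> (nat \<Rightarrow> nat set) \<Rightarrow> (nat \<Rightarrow> nat) pmf" where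
  "choices_pmf \<theta> m S = Pi_pmf {..<m} 0 (\<lambda>t. luce_pmf \<theta> (S t))"

definition loglik :: "nat \<Rightarrow> (nat \<Rightarrow> nat set) \<Rightarrow> (nat \<Rightarrow> nat) \<Rightarrow> (nat \<Rightarrow> real) \<Rightarrow> real" where
  "loglik m S y \<theta> = (\<Sum>t<m. ln (luce_prob \<theta> (S t) (y t)))"

definition Theta :: "nat \<Rightarrow> real \<Rightarrow> (nat \<Rightarrow> real) set" where
  "Theta n b = {\<theta>. (\<forall>i<n. \<bar>\<theta> i\<bar> \<le> b) \<and> (\<forall>i\<ge>n. \<theta> i = 0) \<and> (\<Sum>i<n. \<theta> i) = 0}"

definition MSE :: "nat \<Rightarrow> (nat \<Rightarrow> real) \<Rightarrow> (nat \<Rightarrow> real) \<Rightarrow> real" where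
  "MSE n \<theta>1 \<theta>2 = (1 / real n) * (\<Sum>i<n. (\<theta>1 i - \<theta>2 i)^2)"

definition cooc_mat :: "nat \<Rightarrow> nat \<Rightarrow> (nat \<Rightarrow> nat set) \<Rightarrow> real mat" where
  "cooc_mat n m S = mat n n (\<lambda>(i,j). if i = j then 0
      else real n / real m * real (card {t. t < m \<and> {i, j} \<subseteq> S t}))"

definition laplacian :: "real mat \<Rightarrow> real mat" where
  "laplacian A = mat (dim_row A) (dim_col A)
      (\<lambda>(i,j). (if i = j then (\<Sum>l<dim_col A. A $$ (i,l)) else 0) - A $$ (i,j))"

definition lambda2 :: "real mat \<Rightarrow> real" where
  "lambda2 A = sorted_list_of_multiset (proots (char_poly A)) ! 1"

end

theory Submission
  imports Defs
begin

text \<open>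
  The score (the gradient of the log-likelihood at the true parameter) is a sum of independent
  centred random vectors of Euclidean norm at most \<open>sqrt 2\<close>. Since \<open>cosh (sqrt q)\<close> is convex in \<open>q\<close>,
  adding a centred vector of norm at most \<open>c\<close> multiplies the expectation of the \<open>cosh\<close> of the norm
  by at most \<open>cosh c\<close>; this yields a dimension-free sub-Gaussian tail bound for the norm of the score.

  On \<open>[-b, b]\<close> every choice probability is at least \<open>exp (-2b) / k\<close>, so a second-order Taylor expansion
  bounds the gain in log-likelihood by a linear term in the score minus a multiple of the Laplacian
  quadratic form of the error. The latter dominates \<open>lambda2\<close> times the squared norm of the error,
  because the error sums to zero. As the gain of a maximiser is nonnegative, the norm of the error is
  bounded by a multiple of the norm of the score.
\<close>

section \<open>Tail bound for sums of independent centred vectors\<close>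

lemma convex_on_nonneg_power: "convex_on {0..} (\<lambda>x::real. x ^ n)"
  using convex_on_subset[OF convex_power_even, of n "{0..}"] convex_power_odd[of n]
  by (cases "even n") auto

text \<open>Only even powers occur in the series of \<open>cosh\<close>, so the square root
  disappears and a power series in \<open>q\<close> with nonnegative coefficients remains.\<close>

lemma cosh_sqrt_sums:
  assumes "q \<ge> (0::real)"
  shows "(\<lambda>j. q ^ j / fact (2 * j)) sums cosh (sqrt q)"
proof -
  let ?f = "\<lambda>n. if even n then sqrt q ^ n /\<^sub>R fact n else 0"
  have "?f n = 0" if "n \<notin> range ((*) 2)" for n
    using that by (auto elim: evenE)
  then have "(\<lambda>j. ?f (2 * j)) sums cosh (sqrt q)"
    using sums_mono_reindex[of "(*) 2" ?f] cosh_converges[of "sqrt q"]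
    by (simp only: strict_mono_def) simp
  moreover have "?f (2 * j) = q ^ j / fact (2 * j)" for j
  proof -
    have "sqrt q ^ (2 * j) = q ^ j" using assms by (simp only: power_mult real_sqrt_pow2)
    then show ?thesis by (simp add: divide_inverse_commute)
  qed
  ultimately show ?thesis by (simp only:)
qed

text \<open>Every monomial is convex on the half line and the coefficients of the series are
  nonnegative, so the convexity inequality can be summed term by term.\<close>

lemma convex_on_cosh_sqrt: "convex_on {0..} (\<lambda>q::real. cosh (sqrt q))"
proof (rule convex_onI)
  fix t x y :: real
  assume t: "0 < t" "t < 1" and xy: "x \<in> {0..}" "y \<in> {0..}"
  let ?z = "(1 - t) *\<^sub>R x + t *\<^sub>R y"
  have z: "?z \<ge> 0" using t xy by simp
  have "(\<lambda>j. (1 - t) * (x ^ j / fact (2*j)) + t * (y ^ j / fact (2*j)))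
          sums ((1 - t) * cosh (sqrt x) + t * cosh (sqrt y))"
    using xy by (intro sums_add sums_mult cosh_sqrt_sums) auto
  moreover have "?z ^ j / fact (2*j) \<le> (1 - t) * (x ^ j / fact (2*j)) + t * (y ^ j / fact (2*j))"
    for j
  proof -
    have "?z ^ j \<le> (1 - t) * x ^ j + t * y ^ j"
      using convex_onD[OF convex_on_nonneg_power, of t x y j] t xy by simp
    then have "?z ^ j / fact (2*j) \<le> ((1 - t) * x ^ j + t * y ^ j) / fact (2*j)"
      by (intro divide_right_mono) auto
    then show ?thesis by (simp add: add_divide_distrib)
  qed
  ultimately show "cosh (sqrt ?z) \<le> (1 - t) * cosh (sqrt x) + t * cosh (sqrt y)"
    by (metis (no_types, lifting) sums_le cosh_sqrt_sums[OF z])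
qed simp

text \<open>
  The chord of the convex function \<open>cosh (sqrt q)\<close> between \<open>(a - c)\<^sup>2\<close> and \<open>(a + c)\<^sup>2\<close> gives a bound that
  is affine in the inner product. For \<open>a * c = 0\<close> the quotient is \<open>0\<close> and so is the inner product.
\<close>

lemma cosh_L2_set_add_le:
  fixes x v :: "'i \<Rightarrow> real"
  assumes c: "L2_set v I \<le> c"
  defines "a \<equiv> L2_set x I"
  shows "cosh (L2_set (\<lambda>i. x i + v i) I)
           \<le> cosh a * cosh c + sinh a * sinh c / (a * c) * (\<Sum>i\<in>I. x i * v i)"
proof -
  define d where "d = (\<Sum>i\<in>I. x i * v i)"
  have nn: "a \<ge> 0" "L2_set v I \<ge> 0" "c \<ge> 0"
    using c order_trans[OF L2_set_nonneg c] by (auto simp: a_def)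
  have sq: "(L2_set f I)\<^sup>2 = (\<Sum>i\<in>I. (f i)\<^sup>2)" for f
    by (simp add: L2_set_def sum_nonneg)
  have "\<bar>d\<bar> \<le> (\<Sum>i\<in>I. \<bar>x i\<bar> * \<bar>v i\<bar>)"
    unfolding d_def by (rule order_trans[OF sum_abs]) (simp add: abs_mult)
  also have "\<dots> \<le> a * L2_set v I" unfolding a_def by (rule L2_set_mult_ineq)
  also have "\<dots> \<le> a * c" using c nn by (intro mult_left_mono) auto
  finally have d: "\<bar>d\<bar> \<le> a * c" .
  \<comment> \<open>Replacing the norm of \<open>v\<close> by its bound \<open>c\<close> gives a
    quantity affine in \<open>d\<close>, equal to \<open>(a - c)\<^sup>2\<close> at
    \<open>d = - (a * c)\<close> and to \<open>(a + c)\<^sup>2\<close> at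
    \<open>d = a * c\<close>.\<close>
  define q where "q = a\<^sup>2 + c\<^sup>2 + 2 * d"
  have "(L2_set (\<lambda>i. x i + v i) I)\<^sup>2 = a\<^sup>2 + (L2_set v I)\<^sup>2 + 2 * d"
    unfolding a_def sq d_def
    by (simp add: power2_sum sum.distrib sum_distrib_left mult.assoc)
  also have "\<dots> \<le> q"
    unfolding q_def using power_mono[OF c nn(2), of 2] by simp
  finally have le: "(L2_set (\<lambda>i. x i + v i) I)\<^sup>2 \<le> q" .
  then have "L2_set (\<lambda>i. x i + v i) I \<le> sqrt q"
    by (simp add: real_le_rsqrt)
  then have "cosh (L2_set (\<lambda>i. x i + v i) I) \<le> cosh (sqrt q)"
    using order_trans[OF zero_le_power2 le] by (subst cosh_real_nonneg_le_iff) auto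
  also have "cosh (sqrt q) \<le> cosh a * cosh c + sinh a * sinh c / (a * c) * d"
  proof (cases "a * c = 0")
    case True
    then have "d = 0" using d by (metis abs_le_zero_iff)
    then show ?thesis using True nn by (auto simp: q_def)
  next
    case False
    then have ac: "a * c > 0" using nn by (simp add: less_le)
    \<comment> \<open>The weight that writes \<open>q\<close> as a combination of these two
      endpoints; Cauchy-Schwarz places it in the unit interval.\<close>
    define t where "t = (1 + d / (a * c)) / 2"
    have "\<bar>d / (a * c)\<bar> \<le> 1"
      using d ac by (simp only: abs_divide abs_of_pos) (simp add: divide_le_eq)
    then have "d / (a * c) \<le> 1" "- (d / (a * c)) \<le> 1" by (simp_all only: abs_le_iff)
    then have t: "0 \<le> t" "t \<le> 1" by (simp_all add: t_def abs_le_iff)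
    have "q = (1 - t) * (a - c)\<^sup>2 + t * (a + c)\<^sup>2"
      using False by (simp add: t_def q_def field_simps power2_eq_square)
    then have "cosh (sqrt q) \<le> (1 - t) * cosh (sqrt ((a - c)\<^sup>2)) + t * cosh (sqrt ((a + c)\<^sup>2))"
      using convex_onD[OF convex_on_cosh_sqrt t, of "(a - c)\<^sup>2" "(a + c)\<^sup>2"] by simp
    also have "\<dots> = (1 - t) * cosh (a - c) + t * cosh (a + c)"
      by simp
    also have "\<dots> = cosh a * cosh c + (2 * t - 1) * (sinh a * sinh c)"
      by (simp add: cosh_add cosh_diff algebra_simps)
    also have "2 * t - 1 = d / (a * c)" by (simp add: t_def add_divide_distrib)
    finally show ?thesis by (simp add: mult_ac)
  qed
  finally show ?thesis by (simp add: d_def)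
qed

text \<open>The two power series compare term by term, because
  \<open>2 ^ j * fact j \<le> fact (2 * j)\<close>.\<close>

lemma cosh_le_exp_half_square: "cosh x \<le> exp (x\<^sup>2 / 2)" for x :: real
proof -
  have "(\<lambda>j. (x\<^sup>2) ^ j / fact (2 * j)) sums cosh x"
    using cosh_sqrt_sums[of "x\<^sup>2"] by simp
  moreover have "(\<lambda>j. (x\<^sup>2 / 2) ^ j /\<^sub>R fact j) sums exp (x\<^sup>2 / 2)"
    by (rule exp_converges)
  moreover have "(x\<^sup>2) ^ j / fact (2 * j) \<le> (x\<^sup>2 / 2) ^ j /\<^sub>R fact j" for j
  proof -
    have "(2::real) ^ j * fact j \<le> fact (2 * j)"
    proof (induction j)
      case (Suc j)
      have "(2::real) ^ Suc j * fact (Suc j) = real (2 * Suc j) * (2 ^ j * fact j)"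
        by (simp only: power_Suc fact_Suc of_nat_mult of_nat_numeral mult_ac)
      also have "\<dots> \<le> real (2 * Suc j) * (real (2 * j + 1) * fact (2 * j))"
        using order_trans[OF Suc, of "real (2 * j + 1) * fact (2 * j)"]
        by (intro mult_left_mono) simp_all
      also have "\<dots> = fact (2 * Suc j)" by (simp add: algebra_simps)
      finally show ?case .
    qed simp
    then have "(x\<^sup>2) ^ j / fact (2 * j) \<le> (x\<^sup>2) ^ j / (2 ^ j * fact j)"
      by (intro divide_left_mono) (auto intro: mult_pos_pos)
    then show ?thesis by (simp add: power_divide field_simps)
  qed
  ultimately show ?thesis by (metis (no_types, lifting) sums_le)
qed

text \<open>The affine bound of \<open>cosh_L2_set_add_le\<close> loses its linear term under the
  expectation, as the increment is centred. Finite support makes all integrands integrable.\<close>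

lemma expectation_cosh_L2_set_add_le:
  fixes x :: "'i \<Rightarrow> real" and \<xi> :: "'b \<Rightarrow> 'i \<Rightarrow> real"
  assumes fin: "finite (set_pmf p)"
    and bound: "\<And>y. y \<in> set_pmf p \<Longrightarrow> L2_set (\<xi> y) I \<le> c"
    and mean: "\<And>i. i \<in> I \<Longrightarrow> measure_pmf.expectation p (\<lambda>y. \<xi> y i) = 0"
  shows "measure_pmf.expectation p (\<lambda>y. cosh (L2_set (\<lambda>i. x i + \<xi> y i) I))
           \<le> cosh c * cosh (L2_set x I)"
proof -
  let ?a = "L2_set x I"
  note [simp] = integrable_measure_pmf_finite[OF fin]
  have "measure_pmf.expectation p (\<lambda>y. cosh (L2_set (\<lambda>i. x i + \<xi> y i) I))
     \<le> measure_pmf.expectation p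
         (\<lambda>y. cosh ?a * cosh c + sinh ?a * sinh c / (?a * c) * (\<Sum>i\<in>I. x i * \<xi> y i))"
    by (intro integral_mono_AE) (auto simp: AE_measure_pmf_iff simp del: times_divide_eq_left
          intro!: cosh_L2_set_add_le bound)
  also have "\<dots> = cosh ?a * cosh c
      + sinh ?a * sinh c / (?a * c) * (\<Sum>i\<in>I. x i * measure_pmf.expectation p (\<lambda>y. \<xi> y i))"
    by (simp add: Bochner_Integration.integral_sum)
  finally show ?thesis by (simp add: mean mult.commute)
qed

text \<open>Induction over the independent summands, conditioning on the new one; the shift
  \<open>x\<close> stays general so that it can absorb the value already drawn.\<close>

lemma expectation_cosh_L2_set_sum_le:
  fixes x :: "'i \<Rightarrow> real" and \<xi> :: "'t \<Rightarrow> 'b \<Rightarrow> 'i \<Rightarrow> real"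
  assumes "finite A"
    and fin: "\<And>t. t \<in> A \<Longrightarrow> finite (set_pmf (p t))"
    and bound: "\<And>t y. t \<in> A \<Longrightarrow> y \<in> set_pmf (p t) \<Longrightarrow> L2_set (\<xi> t y) I \<le> c"
    and mean: "\<And>t i. t \<in> A \<Longrightarrow> i \<in> I \<Longrightarrow> measure_pmf.expectation (p t) (\<lambda>y. \<xi> t y i) = 0"
  shows "measure_pmf.expectation (Pi_pmf A dflt p)
           (\<lambda>y. cosh (L2_set (\<lambda>i. x i + (\<Sum>t\<in>A. \<xi> t (y t) i)) I))
         \<le> cosh c ^ card A * cosh (L2_set x I)"
  using assms
proof (induction A arbitrary: x rule: finite_induct)
  case (insert s A)
  let ?F = "\<lambda>B x y. cosh (L2_set (\<lambda>i. x i + (\<Sum>t\<in>B. \<xi> t (y t) i)) I)"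
  have finPi: "finite (set_pmf (Pi_pmf A dflt p))"
    using insert by (simp add: set_Pi_pmf finite_PiE_dflt)
  have "measure_pmf.expectation (Pi_pmf (insert s A) dflt p) (?F (insert s A) x)
     = (\<Sum>z\<in>set_pmf (p s). pmf (p s) z *\<^sub>R
          measure_pmf.expectation (map_pmf (\<lambda>f. f(s := z)) (Pi_pmf A dflt p)) (?F (insert s A) x))"
    using insert.hyps insert.prems finPi
    by (subst Pi_pmf_insert', simp, simp, unfold map_pmf_def[symmetric],
        subst pmf_expectation_bind[of "set_pmf (p s)"]) auto
  also have "\<dots> = (\<Sum>z\<in>set_pmf (p s). pmf (p s) z *
          measure_pmf.expectation (Pi_pmf A dflt p) (?F A (\<lambda>i. x i + \<xi> s z i)))"
  proof -
    \<comment> \<open>The drawn value moves into the shift; the update at \<open>s\<close> leaves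
      the sum over \<open>A\<close> alone, since \<open>s\<close> is not in
      \<open>A\<close>.\<close>
    have "?F (insert s A) x (f(s := z)) = ?F A (\<lambda>i. x i + \<xi> s z i) f" for f z
    proof -
      have "(\<Sum>t\<in>A. \<xi> t ((f(s := z)) t) i) = (\<Sum>t\<in>A. \<xi> t (f t) i)" for i
        using insert.hyps by (intro sum.cong) auto
      then show ?thesis using insert.hyps by (simp add: add.assoc)
    qed
    then show ?thesis by simp
  qed
  also have "\<dots> \<le> (\<Sum>z\<in>set_pmf (p s). pmf (p s) z *
      (cosh c ^ card A * cosh (L2_set (\<lambda>i. x i + \<xi> s z i) I)))"
    using insert.prems by (intro sum_mono mult_left_mono insert.IH) auto
  also have "\<dots> = cosh c ^ card A *
      measure_pmf.expectation (p s) (\<lambda>z. cosh (L2_set (\<lambda>i. x i + \<xi> s z i) I))"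
    using insert.prems(1)[of s]
    by (subst integral_measure_pmf_real[of "set_pmf (p s)"]) 
       (auto simp: sum_distrib_left mult_ac)
  also have "\<dots> \<le> cosh c ^ card A * (cosh c * cosh (L2_set x I))"
    using insert.prems by (intro mult_left_mono expectation_cosh_L2_set_add_le) auto
  finally show ?case using insert.hyps by (simp add: mult_ac)
qed simp

text \<open>Markov's inequality for \<open>cosh\<close> of the scaled norm. The factor 2 comes from
  \<open>exp z / 2 \<le> cosh z\<close>.\<close>

lemma prob_L2_set_sum_ge_le:
  fixes \<xi> :: "'t \<Rightarrow> 'b \<Rightarrow> 'i \<Rightarrow> real"
  assumes A: "finite A" "A \<noteq> {}"
    and fin: "\<And>t. t \<in> A \<Longrightarrow> finite (set_pmf (p t))"
    and bound: "\<And>t y. t \<in> A \<Longrightarrow> y \<in> set_pmf (p t) \<Longrightarrow> L2_set (\<xi> t y) I \<le> c"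
    and mean: "\<And>t i. t \<in> A \<Longrightarrow> i \<in> I \<Longrightarrow> measure_pmf.expectation (p t) (\<lambda>y. \<xi> t y i) = 0"
    and c: "c > 0" and r: "r \<ge> 0"
  shows "measure_pmf.prob (Pi_pmf A dflt p) {y. L2_set (\<lambda>i. \<Sum>t\<in>A. \<xi> t (y t) i) I \<ge> r}
           \<le> 2 * exp (- (r\<^sup>2) / (2 * c\<^sup>2 * card A))"
proof -
  let ?P = "Pi_pmf A dflt p" and ?X = "\<lambda>y. L2_set (\<lambda>i. \<Sum>t\<in>A. \<xi> t (y t) i) I"
  let ?N = "real (card A)"
  have N: "?N > 0" using A by (simp add: card_gt_0_iff)
  \<comment> \<open>This \<open>l\<close> minimises the exponent
    \<open>?N * ((l * c)\<^sup>2 / 2) - l * r\<close> reached at the end.\<close>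
  define l where "l = r / (c\<^sup>2 * ?N)"
  have l: "l \<ge> 0" using r by (simp add: l_def)
  have finP: "finite (set_pmf ?P)"
    using A fin by (simp add: set_Pi_pmf finite_PiE_dflt)
  have scale: "L2_set (\<lambda>i. l * f i) I = l * L2_set f I" for f
    using l by (simp add: L2_set_right_distrib)
  have "exp (l * r) / 2 * measure_pmf.prob ?P {y. ?X y \<ge> r}
      = measure_pmf.expectation ?P (\<lambda>y. exp (l * r) / 2 * indicator {y. ?X y \<ge> r} y)"
    by simp
  also have "\<dots> \<le> measure_pmf.expectation ?P (\<lambda>y. cosh (l * ?X y))"
  proof (intro integral_mono_AE integrable_measure_pmf_finite[OF finP] AE_pmfI)
    fix y
    show "exp (l * r) / 2 * indicator {y. ?X y \<ge> r} y \<le> cosh (l * ?X y)"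
    proof (cases "?X y \<ge> r")
      case True
      have "exp (l * r) / 2 \<le> cosh (l * r)" by (simp add: cosh_field_def)
      also have "\<dots> \<le> cosh (l * ?X y)"
        using True l r by (subst cosh_real_nonneg_le_iff) (auto intro: mult_left_mono)
      finally show ?thesis using True by simp
    qed simp
  qed
  \<comment> \<open>The factor \<open>l\<close> moves into the summands, whose norms are then at
    most \<open>l * c\<close>; the initial shift is zero.\<close>
  also have "\<dots> = measure_pmf.expectation ?P
                 (\<lambda>y. cosh (L2_set (\<lambda>i. 0 + (\<Sum>t\<in>A. l * \<xi> t (y t) i)) I))"
    by (simp add: scale flip: sum_distrib_left)
  also have "\<dots> \<le> cosh (l * c) ^ card A * cosh (L2_set (\<lambda>i. 0) I)"
    using A fin mean l by (intro expectation_cosh_L2_set_sum_le) 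
      (auto simp: scale intro!: mult_left_mono bound)
  also have "\<dots> = cosh (l * c) ^ card A" by (simp add: L2_set_def)
  also have "\<dots> \<le> exp ((l * c)\<^sup>2 / 2) ^ card A"
    by (intro power_mono cosh_le_exp_half_square) simp
  also have "\<dots> = exp (?N * ((l * c)\<^sup>2 / 2))" by (simp only: exp_of_nat_mult)
  finally have "measure_pmf.prob ?P {y. ?X y \<ge> r} \<le> 2 * (exp (?N * ((l * c)\<^sup>2 / 2)) / exp (l * r))"
    by (simp add: field_simps)
  also have "\<dots> = 2 * exp (?N * ((l * c)\<^sup>2 / 2) - l * r)" by (simp add: exp_diff)
  also have "?N * ((l * c)\<^sup>2 / 2) - l * r = - (r\<^sup>2) / (2 * c\<^sup>2 * ?N)"
    using N c by (simp add: l_def field_simps power2_eq_square)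
  finally show ?thesis .
qed

section \<open>The second smallest eigenvalue of a symmetric matrix with zero row sums\<close>

text \<open>Positions count from 0. If entry 1 exceeded both values, so would all later ones, and
  entry 0 alone would have to hold two members.\<close>

lemma sorted_list_of_multiset_nth_1_le:
  fixes M :: "'a::linorder multiset"
  assumes "{#x, y#} \<subseteq># M"
  shows "sorted_list_of_multiset M ! 1 \<le> max x y"
proof (rule ccontr)
  let ?xs = "sorted_list_of_multiset M"
  assume "\<not> ?xs ! 1 \<le> max x y"
  then have less: "max x y < ?xs ! 1" by (simp only: not_le)
  have "length ?xs \<ge> 2"
    using size_mset_mono[OF assms] by (simp flip: size_mset)
  then obtain a b zs where xs: "?xs = a # b # zs"
    by (auto simp: numeral_2_eq_2 Suc_le_length_iff)
  have big: "max x y < z" if "z \<in># mset (b # zs)" for z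
    using sorted_sorted_list_of_multiset[of M] less that unfolding xs by auto
  have M: "M = add_mset a (mset (b # zs))"
    by (metis mset.simps(2) mset_sorted_list_of_multiset xs)
  have "x \<in># M" using assms by (auto dest: mset_subset_eqD)
  then have "x = a" using big[of x] unfolding M by auto
  \<comment> \<open>Cancelling \<open>x = a\<close> once leaves \<open>y\<close> in the tail, even
    if \<open>x = y\<close>.\<close>
  then have "{#y#} \<subseteq># mset (b # zs)" using assms unfolding M by simp
  then show False using big[of y] by (auto dest: mset_subset_eqD)
qed

text \<open>
  Replacing columns \<open>a\<close> and \<open>b\<close> of the identity by the two eigenvectors gives an invertible matrix \<open>P\<close>;
  the corresponding columns of \<open>(X - A) P\<close> are multiples of \<open>X - \<alpha>\<close> and \<open>X - \<beta>\<close>. The eigenvalues may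
  coincide, in which case the root is counted twice.
\<close>

lemma two_eigenvectors_dvd_char_poly:
  fixes A :: "real mat" and u w :: "nat \<Rightarrow> real"
  assumes A: "A \<in> carrier_mat n n"
    and u: "\<And>i. i < n \<Longrightarrow> (\<Sum>l<n. A $$ (i,l) * u l) = \<alpha> * u i"
    and w: "\<And>i. i < n \<Longrightarrow> (\<Sum>l<n. A $$ (i,l) * w l) = \<beta> * w i"
    and ab: "a < n" "b < n" "u a * w b \<noteq> u b * w a"
  shows "[:-\<alpha>, 1:] * [:-\<beta>, 1:] dvd char_poly A"
proof -
  have neq: "a \<noteq> b" using ab by auto
  interpret C: comm_ring_hom "\<lambda>c::real. [:c:]"
    by unfold_locales auto
  define P where "P = mat n n (\<lambda>(i,j). if j = a then u i else if j = b then w i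
                          else if i = j then 1 else 0)"
  \<comment> \<open>\<open>E\<close> below is diagonal and carries the linear factors pulled out of
    columns \<open>a\<close> and \<open>b\<close>; \<open>Q\<close> is what remains of the
    product.\<close>
  define Q where "Q = mat n n (\<lambda>(i,j). if j = a then [:u i:] else if j = b then [:w i:]
                          else char_poly_matrix A $$ (i,j))"
  define E where "E = mat n n (\<lambda>(i,j). if i = j then (if i = a then [:-\<alpha>, 1:]
                          else if i = b then [:-\<beta>, 1:] else 1) else 0)"
  have carr: "P \<in> carrier_mat n n" "Q \<in> carrier_mat n n" "E \<in> carrier_mat n n"
    "char_poly_matrix A \<in> carrier_mat n n" "map_mat (\<lambda>c. [:c:]) P \<in> carrier_mat n n"
    using A by (auto simp: P_def Q_def E_def)
  \<comment> \<open>For a kernel vector \<open>v\<close>, rows \<open>a\<close> and \<open>b\<close>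
    form a homogeneous 2 by 2 system with nonzero determinant \<open>u a * w b - u b * w a\<close>,
    so these two entries vanish; each other row then reads \<open>v $ i = 0\<close>.\<close>
  have "det P \<noteq> 0"
  proof
    assume "det P = 0"
    then obtain v where v: "v \<in> carrier_vec n" "v \<noteq> 0\<^sub>v n" "P *\<^sub>v v = 0\<^sub>v n"
      using det_0_iff_vec_prod_zero[OF carr(1)] by auto
    have row: "u i * v $ a + w i * v $ b + (if i \<noteq> a \<and> i \<noteq> b then v $ i else 0) = 0"
      if i: "i < n" for i
    proof -
      have "0 = (P *\<^sub>v v) $ i" using v(3) i by simp
      also have "\<dots> = (\<Sum>j = 0..<n. P $$ (i,j) * v $ j)"
        using i carr(1) v(1) by (simp add: scalar_prod_def)
      also have "\<dots> = (\<Sum>j = 0..<n. (if j = a then u i * v $ a else 0)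
           + (if j = b then w i * v $ b else 0)
           + (if j = i then (if i \<noteq> a \<and> i \<noteq> b then v $ i else 0) else 0))"
        using i neq by (intro sum.cong) (auto simp: P_def)
      also have "\<dots> = u i * v $ a + w i * v $ b + (if i \<noteq> a \<and> i \<noteq> b then v $ i else 0)"
        using i ab by (simp add: sum.distrib)
      finally show ?thesis by simp
    qed
    have ra: "u a * v $ a + w a * v $ b = 0" and rb: "u b * v $ a + w b * v $ b = 0"
      using row[OF ab(1)] row[OF ab(2)] by simp_all
    have "(u a * w b - u b * w a) * v $ a = 0"
    proof -
      have "(u a * w b - u b * w a) * v $ a
          = w b * (u a * v $ a + w a * v $ b) - w a * (u b * v $ a + w b * v $ b)"
        by (simp add: algebra_simps)
      then show ?thesis unfolding ra rb by simp
    qed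
    moreover have "(u a * w b - u b * w a) * v $ b = 0"
    proof -
      have "(u a * w b - u b * w a) * v $ b
          = u a * (u b * v $ a + w b * v $ b) - u b * (u a * v $ a + w a * v $ b)"
        by (simp add: algebra_simps)
      then show ?thesis unfolding ra rb by simp
    qed
    ultimately have "v $ a = 0" "v $ b = 0" using ab by auto
    then have "v $ i = 0" if "i < n" for i
      using row[OF that] by (cases "i = a \<or> i = b") auto
    then have "v = 0\<^sub>v n" using v(1) by (intro eq_vecI) auto
    then show False using v(2) by simp
  qed
  have entry: "char_poly_matrix A $$ (i,l) = (if i = l then [:0,1:] else 0) - [:A $$ (i,l):]"
    if "i < n" "l < n" for i l
    using that A by (simp add: char_poly_matrix_def)
  have eig: "(\<Sum>l<n. char_poly_matrix A $$ (i,l) * [:z l:]) = [:z i:] * [:-\<gamma>, 1:]"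
    if i: "i < n" and z: "(\<Sum>l<n. A $$ (i,l) * z l) = \<gamma> * z i" for i z \<gamma>
  proof -
    have "(\<Sum>l<n. char_poly_matrix A $$ (i,l) * [:z l:])
        = (\<Sum>l<n. (if l = i then [:0, z i:] else 0) - [:A $$ (i,l) * z l:])"
      using i by (intro sum.cong) (auto simp: entry)
    also have "\<dots> = [:0, z i:] - [:\<Sum>l<n. A $$ (i,l) * z l:]"
      using i by (simp add: sum_subtractf C.hom_sum)
    also have "\<dots> = [:z i:] * [:-\<gamma>, 1:]" by (simp add: z)
    finally show ?thesis .
  qed
  have "char_poly_matrix A * map_mat (\<lambda>c. [:c:]) P = Q * E"
  proof (rule eq_matI)
    fix i j assume "i < dim_row (Q * E)" "j < dim_col (Q * E)"
    then have ij: "i < n" "j < n" using carr by auto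
    have "(Q * E) $$ (i,j) = (\<Sum>l = 0..<n. Q $$ (i,l) * E $$ (l,j))"
      using ij carr by (simp add: scalar_prod_def)
    also have "\<dots> = (\<Sum>l = 0..<n. if l = j then Q $$ (i,j) * E $$ (j,j) else 0)"
      using ij by (intro sum.cong) (auto simp: E_def)
    also have "\<dots> = Q $$ (i,j) * E $$ (j,j)" using ij by simp
    finally have r: "(Q * E) $$ (i,j) = Q $$ (i,j) * E $$ (j,j)" .
    have l: "(char_poly_matrix A * map_mat (\<lambda>c. [:c:]) P) $$ (i,j)
        = (\<Sum>l<n. char_poly_matrix A $$ (i,l) * [:P $$ (l,j):])"
      using ij carr by (simp add: scalar_prod_def atLeast0LessThan)
    show "(char_poly_matrix A * map_mat (\<lambda>c. [:c:]) P) $$ (i,j) = (Q * E) $$ (i,j)"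
    proof (cases "j = a \<or> j = b")
      case True
      then show ?thesis
        unfolding l r using ij neq eig[OF ij(1) u[OF ij(1)]] eig[OF ij(1) w[OF ij(1)]]
        by (auto simp: P_def Q_def E_def)
    next
      case False
      have "(\<Sum>l<n. char_poly_matrix A $$ (i,l) * [:P $$ (l,j):])
          = (\<Sum>l<n. if l = j then char_poly_matrix A $$ (i,j) else 0)"
        using False ij by (intro sum.cong) (auto simp: P_def)
      then show ?thesis unfolding l r using False ij by (simp add: Q_def E_def)
    qed
  qed (use carr in auto)
  then have "char_poly A * [:det P:] = det Q * det E"
    unfolding char_poly_def C.hom_det[symmetric]
    using det_mult[OF carr(4,5)] det_mult[OF carr(2,3)] by simp
  moreover have "det E = [:-\<alpha>, 1:] * [:-\<beta>, 1:]"
  proof -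
    let ?f = "\<lambda>i. if i = a then [:-\<alpha>, 1:] else if i = b then [:-\<beta>, 1:] else 1"
    have "det E = (\<Prod>i = 0..<n. E $$ (i,i))"
      using det_lower_triangular[OF _ carr(3)] carr(3) by (simp add: E_def prod_list_diag_prod)
    also have "\<dots> = (\<Prod>i\<in>{0..<n}. ?f i)"
      by (intro prod.cong) (auto simp: E_def)
    also have "\<dots> = (\<Prod>i\<in>{a,b}. ?f i)"
      using ab by (intro prod.mono_neutral_right) auto
    also have "\<dots> = [:-\<alpha>, 1:] * [:-\<beta>, 1:]" using neq by simp
    finally show ?thesis .
  qed
  ultimately have "[:-\<alpha>, 1:] * [:-\<beta>, 1:] dvd char_poly A * [:det P:]"
    by (metis dvd_triv_right)
  \<comment> \<open>\<open>det P\<close> is a nonzero constant, hence a unit that does not affect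
    divisibility.\<close>
  moreover have "char_poly A * [:det P:] = Polynomial.smult (det P) (char_poly A)" by simp
  ultimately show ?thesis using \<open>det P \<noteq> 0\<close> by (metis dvd_smult_cancel)
qed

text \<open>Divisibility by the product puts both roots, counted with multiplicity, into the
  multiset of roots.\<close>

lemma lambda2_le_max:
  assumes A: "A \<in> carrier_mat n n" and dvd: "[:-\<alpha>, 1:] * [:-\<beta>, 1:] dvd char_poly A"
  shows "lambda2 A \<le> max \<alpha> \<beta>"
proof -
  obtain r where r: "char_poly A = [:-\<alpha>, 1:] * [:-\<beta>, 1:] * r"
    using dvd by (auto elim: dvdE)
  have "char_poly A \<noteq> 0" using degree_monic_char_poly[OF A] by auto
  then have "r \<noteq> 0" using r by auto
  then have "proots (char_poly A) = {#\<alpha>#} + {#\<beta>#} + proots r"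
    unfolding r by (subst proots_mult, simp, simp, subst proots_mult) simp_all
  then have "{#\<alpha>, \<beta>#} \<subseteq># proots (char_poly A)" by simp
  then show ?thesis unfolding lambda2_def by (rule sorted_list_of_multiset_nth_1_le)
qed

text \<open>By compactness the form attains its minimum over the unit sphere of the sum-zero
  hyperplane; homogeneity of degree two extends the inequality to all sum-zero vectors.\<close>

lemma quad_form_minimizer_exists:
  fixes A :: "nat \<Rightarrow> nat \<Rightarrow> real"
  assumes n: "n \<ge> 2"
  obtains w where "(\<Sum>i<n. w i) = 0" "(\<Sum>i<n. (w i)\<^sup>2) = 1"
    "\<And>x. (\<Sum>i<n. x i) = 0 \<Longrightarrow>
      (\<Sum>i<n. \<Sum>j<n. w i * A i j * w j) * (\<Sum>i<n. (x i)\<^sup>2) \<le> (\<Sum>i<n. \<Sum>j<n. x i * A i j * x j)"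
proof -
  let ?q = "\<lambda>x. \<Sum>i<n. \<Sum>j<n. x i * A i j * x j"
  \<comment> \<open>Coordinates from \<open>n\<close> on are fixed at 0, so \<open>K\<close> is a
    closed part of a product of compact sets; unit norm confines the other coordinates to
    \<open>{-1..1}\<close> anyway.\<close>
  define K where "K = (\<Pi>\<^sub>E i\<in>UNIV. if i < n then {-1..1::real} else {0})
      \<inter> {x. (\<Sum>i<n. x i) = 0} \<inter> {x. (\<Sum>i<n. (x i)\<^sup>2) = 1}"
  have "compactin (product_topology (\<lambda>i::nat. euclidean) UNIV)
          (\<Pi>\<^sub>E i\<in>UNIV. if i < n then {-1..1::real} else {0})"
    by (subst compactin_PiE) auto
  then have "compact (\<Pi>\<^sub>E i\<in>UNIV. if (i::nat) < n then {-1..1::real} else {0})"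
    by (simp only: euclidean_product_topology compactin_euclidean_iff)
  moreover have "closed {x::nat \<Rightarrow> real. (\<Sum>i<n. x i) = 0}" "closed {x::nat \<Rightarrow> real. (\<Sum>i<n. (x i)\<^sup>2) = 1}"
    by (intro closed_Collect_eq continuous_intros continuous_on_product_coordinates)+
  ultimately have "compact K" unfolding K_def by (intro compact_Int_closed)
  have K: "(\<lambda>i. if i < n then x i else 0) \<in> K"
    if x: "(\<Sum>i<n. x i) = 0" "(\<Sum>i<n. (x i)\<^sup>2) = 1" for x
  proof -
    have "x i \<in> {-1..1}" if "i < n" for i
    proof -
      have "(x i)\<^sup>2 \<le> (\<Sum>i<n. (x i)\<^sup>2)" using that by (intro member_le_sum) auto
      then have "\<bar>x i\<bar> \<le> 1" using x by (simp add: abs_square_le_1)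
      then show ?thesis by auto
    qed
    then show ?thesis using x by (auto simp: K_def PiE_def)
  qed
  \<comment> \<open>A point of \<open>K\<close>: the normalised difference of the first two unit
    vectors.\<close>
  have "(\<Sum>i<n. if i = 0 then 1 / sqrt 2 else if i = 1 then - (1 / sqrt 2) else 0 :: real) = 0"
    "(\<Sum>i<n. (if i = 0 then 1 / sqrt 2 else if i = 1 then - (1 / sqrt 2) else 0 :: real)\<^sup>2) = 1"
  proof -
    have "(\<Sum>i<n. f (if i = 0 then 1 / sqrt 2 else if i = 1 then - (1 / sqrt 2) else 0 :: real))
        = f (1 / sqrt 2) + f (- (1 / sqrt 2))" if "f 0 = 0" for f :: "real \<Rightarrow> real"
    proof -
      have "(\<Sum>i<n. f (if i = 0 then 1 / sqrt 2 else if i = 1 then - (1 / sqrt 2) else 0 :: real))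
        = (\<Sum>i\<in>{0,1::nat}. f (if i = 0 then 1 / sqrt 2 else if i = 1 then - (1 / sqrt 2) else 0))"
        using n that by (intro sum.mono_neutral_right) auto
      then show ?thesis by simp
    qed
    from this[of "\<lambda>x. x"] this[of power2] show 
      "(\<Sum>i<n. if i = 0 then 1 / sqrt 2 else if i = 1 then - (1 / sqrt 2) else 0 :: real) = 0"
      "(\<Sum>i<n. (if i = 0 then 1 / sqrt 2 else if i = 1 then - (1 / sqrt 2) else 0 :: real)\<^sup>2) = 1"
      by (simp_all add: power_divide)
  qed
  from K[OF this] have "K \<noteq> {}" by blast
  moreover have "continuous_on UNIV ?q"
    by (intro continuous_intros continuous_on_product_coordinates)
  then have "continuous_on K ?q" by (rule continuous_on_subset) simp
  ultimately obtain w where w: "w \<in> K" "\<And>x. x \<in> K \<Longrightarrow> ?q w \<le> ?q x"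
    using continuous_attains_inf[OF \<open>compact K\<close>] by blast
  show thesis
  proof (rule that[of w])
    show "(\<Sum>i<n. w i) = 0" "(\<Sum>i<n. (w i)\<^sup>2) = 1" using w(1) by (auto simp: K_def)
    fix x :: "nat \<Rightarrow> real" assume x: "(\<Sum>i<n. x i) = 0"
    define s where "s = (\<Sum>i<n. (x i)\<^sup>2)"
    show "?q w * (\<Sum>i<n. (x i)\<^sup>2) \<le> ?q x"
    proof (cases "s = 0")
      case True
      then have "\<forall>i<n. x i = 0" unfolding s_def by (subst (asm) sum_nonneg_eq_0_iff) auto
      then show ?thesis by simp
    next
      case False
      then have s: "s > 0" unfolding s_def by (simp add: less_le sum_nonneg)
      let ?y = "\<lambda>i. x i / sqrt s"
      have "(\<Sum>i<n. ?y i) = 0" "(\<Sum>i<n. (?y i)\<^sup>2) = 1"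
        using x s by (simp_all add: power_divide s_def flip: sum_divide_distrib)
      from w(2)[OF K[OF this]] have "?q w \<le> ?q (\<lambda>i. if i < n then ?y i else 0)" .
      also have "\<dots> = ?q ?y" by (intro sum.cong) auto
      also have "\<dots> = (\<Sum>i<n. \<Sum>j<n. x i * A i j * x j / s)"
      proof -
        have "sqrt s * sqrt s = s" using s by simp
        then show ?thesis by (intro sum.cong) (auto simp: mult_ac)
      qed
      also have "\<dots> = ?q x / s" by (simp flip: sum_divide_distrib)
      finally show ?thesis using s by (simp add: s_def[symmetric] field_simps)
    qed
  qed
qed

text \<open>Courant-Fischer for the second eigenvalue: the constant vector has eigenvalue 0 and the
  constrained minimiser \<open>w\<close> has eigenvalue \<open>\<mu>\<close>, so
  \<open>lambda2\<close> is at most \<open>max 0 \<mu>\<close>. Positivity of \<open>lambda2\<close>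
  reduces this maximum to \<open>\<mu>\<close>.\<close>

lemma lambda2_le_quad_form:
  fixes A :: "nat \<Rightarrow> nat \<Rightarrow> real"
  assumes n: "n \<ge> 2"
    and sym: "\<And>i j. i < n \<Longrightarrow> j < n \<Longrightarrow> A i j = A j i"
    and row: "\<And>i. i < n \<Longrightarrow> (\<Sum>j<n. A i j) = 0"
    and pos: "lambda2 (mat n n (\<lambda>(i,j). A i j)) > 0"
    and x: "(\<Sum>i<n. x i) = 0"
  shows "lambda2 (mat n n (\<lambda>(i,j). A i j)) * (\<Sum>i<n. (x i)\<^sup>2)
           \<le> (\<Sum>i<n. \<Sum>j<n. x i * A i j * x j)"
proof -
  let ?B = "\<lambda>x y. \<Sum>i<n. \<Sum>j<n. x i * A i j * y j" and ?A = "mat n n (\<lambda>(i,j). A i j)"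
  let ?d = "\<lambda>x y. \<Sum>i<n. x i * y i :: real"
  obtain w where w: "(\<Sum>i<n. w i) = 0" "(\<Sum>i<n. (w i)\<^sup>2) = 1"
    and min: "\<And>x. (\<Sum>i<n. x i) = 0 \<Longrightarrow> ?B w w * (\<Sum>i<n. (x i)\<^sup>2) \<le> ?B x x"
    using quad_form_minimizer_exists[OF n] by blast
  define \<mu> where "\<mu> = ?B w w"
  \<comment> \<open>Minimality of \<open>w\<close> along the direction \<open>v\<close> forces \<open>v = 0\<close>, so \<open>w\<close> is an eigenvector.\<close>
  define v where "v = (\<lambda>i. (\<Sum>j<n. A i j * w j) - \<mu> * w i)"
  define N where "N = (\<Sum>i<n. (v i)\<^sup>2)"
  have Bvw: "?B v w - \<mu> * ?d v w = N"
  proof -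
    have "?B v w - \<mu> * ?d v w = (\<Sum>i<n. v i * ((\<Sum>j<n. A i j * w j) - \<mu> * w i))"
      by (simp add: sum_distrib_left sum_subtractf right_diff_distrib mult_ac)
    then show ?thesis by (simp add: N_def v_def power2_eq_square)
  qed
  have Bwv: "?B w v = ?B v w"
    by (subst sum.swap) (auto intro!: sum.cong simp: sym mult_ac)
  \<comment> \<open>Keeps \<open>w + t * v\<close> in the sum-zero hyperplane; by symmetry the
    column sums vanish too.\<close>
  have sum_v: "(\<Sum>i<n. v i) = 0"
  proof -
    have "(\<Sum>i<n. \<Sum>j<n. A i j * w j) = (\<Sum>j<n. \<Sum>i<n. A i j * w j)" by (rule sum.swap)
    also have "\<dots> = (\<Sum>j<n. (\<Sum>i<n. A j i) * w j)"
      by (auto intro!: sum.cong simp: sum_distrib_right sym)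
    also have "\<dots> = 0" by (simp add: row)
    finally show ?thesis
      by (simp add: v_def sum_subtractf w flip: sum_distrib_left)
  qed
  define c where "c = ?B v v - \<mu> * N"
  \<comment> \<open>Minimality along the line through \<open>w\<close>: the constant term cancels,
    and the linear coefficient is \<open>2 * N\<close> by \<open>Bvw\<close> and symmetry.\<close>
  have quad: "0 \<le> 2 * t * N + t\<^sup>2 * c" for t
  proof -
    let ?x = "\<lambda>i. w i + t * v i"
    have "(\<Sum>i<n. ?x i) = 0" using w sum_v by (simp add: sum.distrib flip: sum_distrib_left)
    from min[OF this] have "\<mu> * (\<Sum>i<n. (?x i)\<^sup>2) \<le> ?B ?x ?x" by (simp add: \<mu>_def)
    moreover have "?B ?x ?x = \<mu> + 2 * t * ?B v w + t\<^sup>2 * ?B v v"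
    proof -
      have "?B ?x ?x = ?B w w + t * ?B v w + t * ?B w v + t\<^sup>2 * ?B v v"
        by (simp add: sum_distrib_left algebra_simps power2_eq_square flip: sum.distrib)
      then show ?thesis unfolding Bwv \<mu>_def by simp
    qed
    moreover have "(\<Sum>i<n. (?x i)\<^sup>2) = 1 + 2 * t * ?d v w + t\<^sup>2 * N"
    proof -
      have "(\<Sum>i<n. (?x i)\<^sup>2) = (\<Sum>i<n. (w i)\<^sup>2) + 2 * t * ?d v w + t\<^sup>2 * N"
        unfolding N_def
        by (simp add: sum_distrib_left algebra_simps power2_eq_square flip: sum.distrib)
      then show ?thesis using w by simp
    qed
    ultimately have "\<mu> * (1 + 2 * t * ?d v w + t\<^sup>2 * N) \<le> \<mu> + 2 * t * ?B v w + t\<^sup>2 * ?B v v"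
      by simp
    then show ?thesis unfolding c_def Bvw[symmetric] by (simp add: algebra_simps)
  qed
  have "N = 0"
  proof (rule ccontr)
    assume "N \<noteq> 0"
    then have N: "N > 0" unfolding N_def by (simp add: less_le sum_nonneg)
    \<comment> \<open>Negative, and so small that \<open>t * c\<close> stays below \<open>N\<close>
      in absolute value: the linear term wins and contradicts \<open>quad\<close>.\<close>
    define t where "t = - N / (\<bar>c\<bar> + 1)"
    have t: "t < 0" using N by (simp add: t_def divide_neg_pos)
    have "N * \<bar>c\<bar> < N * (\<bar>c\<bar> + 1)" using N by simp
    then have "\<bar>t * c\<bar> < N"
      using N by (simp add: t_def abs_mult divide_less_eq)
    then have "2 * N + t * c > 0" using N by linarith
    then have "t * (2 * N + t * c) < 0" using t by (simp add: mult_neg_pos)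
    then show False using quad[of t] by (simp add: algebra_simps power2_eq_square)
  qed
  then have eig: "(\<Sum>j<n. A i j * w j) = \<mu> * w i" if "i < n" for i
    using that unfolding N_def by (subst (asm) sum_nonneg_eq_0_iff) (auto simp: v_def)
  \<comment> \<open>A unit vector summing to zero is not constant; entries 0 and \<open>j\<close>
    show that \<open>w\<close> and the constant vector are independent.\<close>
  obtain j where j: "j < n" "w j \<noteq> w 0"
  proof -
    have "\<not> (\<forall>j<n. w j = w 0)"
    proof
      assume eq: "\<forall>j<n. w j = w 0"
      have "(\<Sum>i<n. w i) = (\<Sum>i<n. w 0)" by (rule sum.cong) (use eq in blast)+
      then have "w 0 = 0" using w n by simp
      with eq have "\<forall>j<n. w j = 0" by metis
      then show False using w by simp
    qed
    then show thesis using that by blast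
  qed
  have "[:-0, 1:] * [:-\<mu>, 1:] dvd char_poly ?A"
  proof (rule two_eigenvectors_dvd_char_poly)
    show "?A \<in> carrier_mat n n" by simp
    show "(\<Sum>l<n. ?A $$ (i,l) * 1) = 0 * 1" if "i < n" for i using that row by simp
    show "(\<Sum>l<n. ?A $$ (i,l) * w l) = \<mu> * w i" if "i < n" for i using that eig by simp
    show "0 < n" "j < n" "1 * w j \<noteq> 1 * w 0" using n j by auto
  qed
  then have "lambda2 ?A \<le> max 0 \<mu>" by (intro lambda2_le_max[of _ n]) auto
  then have "lambda2 ?A \<le> \<mu>" using pos by simp
  then have "lambda2 ?A * (\<Sum>i<n. (x i)\<^sup>2) \<le> \<mu> * (\<Sum>i<n. (x i)\<^sup>2)"
    by (intro mult_right_mono sum_nonneg) auto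
  also have "\<dots> \<le> ?B x x" using min[OF x] by (simp add: \<mu>_def)
  finally show ?thesis .
qed

section \<open>The Luce model\<close>

text \<open>Second-order Taylor expansion along the segment. The second derivative is the variance
  of \<open>\<delta>\<close> under the tilted choice probabilities, half a weighted sum of squared
  differences; weights at least \<open>exp (- b)\<close> and a normaliser at most
  \<open>card S * exp b\<close> give the constant.\<close>

lemma log_sum_exp_lower_bound:
  fixes \<theta> \<delta> :: "'a \<Rightarrow> real"
  assumes S: "finite S" "S \<noteq> {}"
    and b: "\<And>v. v \<in> S \<Longrightarrow> \<bar>\<theta> v\<bar> \<le> b" "\<And>v. v \<in> S \<Longrightarrow> \<bar>\<theta> v + \<delta> v\<bar> \<le> b"
  shows "ln (\<Sum>v\<in>S. exp (\<theta> v + \<delta> v))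
     \<ge> ln (\<Sum>v\<in>S. exp (\<theta> v)) + (\<Sum>v\<in>S. exp (\<theta> v) / (\<Sum>u\<in>S. exp (\<theta> u)) * \<delta> v)
       + exp (- 4 * b) / (4 * (card S)\<^sup>2) * (\<Sum>u\<in>S. \<Sum>v\<in>S. (\<delta> u - \<delta> v)\<^sup>2)"
proof -
  define e where "e = (\<lambda>s v. exp (\<theta> v + s * \<delta> v))"
  \<comment> \<open>The normaliser along the segment, followed by its first two derivatives in
    \<open>s\<close>.\<close>
  define Z where "Z = (\<lambda>s. \<Sum>v\<in>S. e s v)"
  define Z1 where "Z1 = (\<lambda>s. \<Sum>v\<in>S. \<delta> v * e s v)"
  define Z2 where "Z2 = (\<lambda>s. \<Sum>v\<in>S. (\<delta> v)\<^sup>2 * e s v)"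
  define V where "V = (\<Sum>u\<in>S. \<Sum>v\<in>S. (\<delta> u - \<delta> v)\<^sup>2)"
  have Zpos: "Z s > 0" for s unfolding Z_def e_def using S by (intro sum_pos) auto
  have de: "((\<lambda>s. e s v) has_real_derivative \<delta> v * e s v) (at s)" for s v
    unfolding e_def by (auto intro!: derivative_eq_intros)
  have dZ: "(Z has_real_derivative Z1 s) (at s)" for s
    unfolding Z_def Z1_def by (intro DERIV_sum de)
  have dZ1: "(Z1 has_real_derivative Z2 s) (at s)" for s
    unfolding Z1_def Z2_def power2_eq_square mult.assoc by (intro DERIV_sum DERIV_cmult de)
  define D where "D = (\<lambda>i::nat. if i = 0 then (\<lambda>s. ln (Z s)) else if i = 1 then (\<lambda>s. Z1 s / Z s)
                     else (\<lambda>s. (Z2 s * Z s - (Z1 s)\<^sup>2) / (Z s)\<^sup>2))"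
  have d0: "((\<lambda>s. ln (Z s)) has_real_derivative Z1 s / Z s) (at s)" for s
    using Zpos[of s] by (auto intro!: derivative_eq_intros dZ)
  have d1: "((\<lambda>s. Z1 s / Z s) has_real_derivative (Z2 s * Z s - (Z1 s)\<^sup>2) / (Z s)\<^sup>2) (at s)" for s
    using DERIV_divide[OF dZ1[of s] dZ[of s]] Zpos[of s]
    by (simp add: power2_eq_square)
  have "\<exists>t>0. t \<le> 1 \<and> D 0 1 = (\<Sum>i<2. D i 0 / fact i * 1 ^ i) + D 2 t / fact 2 * 1 ^ 2"
  proof (rule Maclaurin2)
    show "\<forall>i t. i < 2 \<and> 0 \<le> t \<and> t \<le> 1 \<longrightarrow> DERIV (D i) t :> D (Suc i) t"
      using d0 d1 by (auto simp: D_def less_2_cases_iff)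
  qed auto
  then obtain t where t: "0 < t" "t \<le> 1"
    and taylor: "ln (Z 1) = ln (Z 0) + Z1 0 / Z 0 + (Z2 t * Z t - (Z1 t)\<^sup>2) / (Z t)\<^sup>2 / 2"
    by (auto simp: D_def numeral_2_eq_2)
  have bt: "\<bar>\<theta> v + t * \<delta> v\<bar> \<le> b" if "v \<in> S" for v
  proof -
    have "\<theta> v + t * \<delta> v = (1 - t) * \<theta> v + t * (\<theta> v + \<delta> v)" by (simp add: algebra_simps)
    also have "\<bar>\<dots>\<bar> \<le> (1 - t) * \<bar>\<theta> v\<bar> + t * \<bar>\<theta> v + \<delta> v\<bar>"
      using t by (intro order_trans[OF abs_triangle_ineq]) (simp add: abs_mult)
    also have "\<dots> \<le> (1 - t) * b + t * b"
      using t b[OF that] by (intro add_mono mult_left_mono) auto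
    finally show ?thesis by (simp add: algebra_simps)
  qed
  have e_ge: "e t v \<ge> exp (- b)" and e_le: "e t v \<le> exp b" if "v \<in> S" for v
    using bt[OF that] by (auto simp: e_def abs_le_iff)
  \<comment> \<open>Symmetrising over pairs turns the numerator of the variance into squared
    differences with positive weights.\<close>
  have "2 * (Z2 t * Z t - (Z1 t)\<^sup>2) = (\<Sum>u\<in>S. \<Sum>v\<in>S. e t u * e t v * (\<delta> u - \<delta> v)\<^sup>2)"
  proof -
    have "(\<Sum>u\<in>S. \<Sum>v\<in>S. e t u * e t v * (\<delta> u - \<delta> v)\<^sup>2)
      = (\<Sum>u\<in>S. \<Sum>v\<in>S. ((\<delta> u)\<^sup>2 * e t u) * e t v + e t u * ((\<delta> v)\<^sup>2 * e t v)
           - 2 * ((\<delta> u * e t u) * (\<delta> v * e t v)))"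
      by (intro sum.cong) (auto simp: power2_eq_square algebra_simps)
    also have "\<dots> = Z2 t * Z t + Z t * Z2 t - 2 * (Z1 t * Z1 t)"
      unfolding Z_def Z1_def Z2_def sum_product
      by (simp add: sum.distrib sum_subtractf sum_distrib_left)
    finally show ?thesis by (simp add: power2_eq_square)
  qed
  also have "\<dots> \<ge> (\<Sum>u\<in>S. \<Sum>v\<in>S. exp (- b) * exp (- b) * (\<delta> u - \<delta> v)\<^sup>2)"
    using e_ge by (intro sum_mono mult_right_mono mult_mono) (auto simp: e_def)
  finally have "2 * (Z2 t * Z t - (Z1 t)\<^sup>2) \<ge> exp (- 2 * b) * V"
    by (simp add: V_def sum_distrib_left exp_add[symmetric])
  then have num: "Z2 t * Z t - (Z1 t)\<^sup>2 \<ge> exp (- 2 * b) * V / 2" by simp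
  have "Z t \<le> card S * exp b"
    unfolding Z_def using sum_bounded_above[of S "e t" "exp b"] e_le by simp
  then have "(Z t)\<^sup>2 \<le> (card S * exp b)\<^sup>2"
    using Zpos[of t] by (intro power_mono) auto
  also have "\<dots> = (card S)\<^sup>2 * exp (2 * b)"
    by (simp add: power_mult_distrib exp_double)
  finally have den: "(Z t)\<^sup>2 \<le> (card S)\<^sup>2 * exp (2 * b)" .
  have "exp (- 4 * b) / (4 * (card S)\<^sup>2) * V
      = (exp (- 2 * b) * V / 2) / ((card S)\<^sup>2 * exp (2 * b)) / 2"
  proof -
    have "exp (- 4 * b) = exp (- 2 * b) / exp (2 * b)" by (simp flip: exp_diff)
    then show ?thesis by simp
  qed
  also have "\<dots> \<le> (Z2 t * Z t - (Z1 t)\<^sup>2) / (Z t)\<^sup>2 / 2"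
  proof -
    have "V \<ge> 0" by (simp add: V_def sum_nonneg)
    then have "Z2 t * Z t - (Z1 t)\<^sup>2 \<ge> 0" by (intro order_trans[OF _ num]) simp
    then show ?thesis
      using num den Zpos[of t] by (intro divide_right_mono frac_le) simp_all
  qed
  finally have "ln (Z 1) \<ge> ln (Z 0) + Z1 0 / Z 0 + exp (- 4 * b) / (4 * (card S)\<^sup>2) * V"
    unfolding taylor by simp
  moreover have "Z1 0 / Z 0 = (\<Sum>v\<in>S. exp (\<theta> v) / (\<Sum>u\<in>S. exp (\<theta> u)) * \<delta> v)"
    by (simp add: Z1_def Z_def e_def sum_divide_distrib mult.commute)
  ultimately show ?thesis by (simp add: Z_def e_def V_def)
qed

section \<open>Choice distribution and score vector\<close>

lemma sum_luce_prob:
  assumes "finite S" "S \<noteq> {}"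
  shows "(\<Sum>i\<in>S. luce_prob \<theta> S i) = 1"
proof -
  have "(\<Sum>v\<in>S. exp (\<theta> v)) > 0" using assms by (intro sum_pos) auto
  then show ?thesis by (simp add: luce_prob_def flip: sum_divide_distrib)
qed

lemma luce_prob_pos: "finite S \<Longrightarrow> S \<noteq> {} \<Longrightarrow> luce_prob \<theta> S i > 0"
  unfolding luce_prob_def by (intro divide_pos_pos sum_pos) auto

lemma pmf_luce_pmf:
  assumes S: "finite S" "S \<noteq> {}"
  shows "pmf (luce_pmf \<theta> S) i = (if i \<in> S then luce_prob \<theta> S i else 0)"
  unfolding luce_pmf_def
proof (rule pmf_embed_pmf)
  show "0 \<le> (if i \<in> S then luce_prob \<theta> S i else 0)" for i
    using luce_prob_pos[OF S, of \<theta> i] by simp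
  have "(\<integral>\<^sup>+ i. ennreal (if i \<in> S then luce_prob \<theta> S i else 0) \<partial>count_space UNIV)
      = (\<Sum>i\<in>S. ennreal (luce_prob \<theta> S i))"
    using S by (subst nn_integral_count_space'[of S]) (auto intro!: sum.cong)
  also have "\<dots> = 1"
    using S luce_prob_pos[OF S] by (subst sum_ennreal) (auto simp: less_imp_le sum_luce_prob)
  finally show "(\<integral>\<^sup>+ i. ennreal (if i \<in> S then luce_prob \<theta> S i else 0) \<partial>count_space UNIV) = 1" .
qed

lemma set_luce_pmf:
  assumes "finite S" "S \<noteq> {}"
  shows "set_pmf (luce_pmf \<theta> S) = S"
  using luce_prob_pos[OF assms] by (auto simp: set_pmf_eq pmf_luce_pmf[OF assms] less_le)

text \<open>Coordinate \<open>i\<close> of the gradient of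
  \<open>ln (luce_prob \<theta> S y)\<close> in \<open>\<theta>\<close>, the contribution of one
  observation.\<close>

definition luce_score :: "(nat \<Rightarrow> real) \<Rightarrow> nat set \<Rightarrow> nat \<Rightarrow> nat \<Rightarrow> real" where
  "luce_score \<theta> S y i = indicator {i} y - (if i \<in> S then luce_prob \<theta> S i else 0)"

lemma expectation_luce_score:
  assumes "finite S" "S \<noteq> {}"
  shows "measure_pmf.expectation (luce_pmf \<theta> S) (\<lambda>y. luce_score \<theta> S y i) = 0"
proof -
  have "measure_pmf.expectation (luce_pmf \<theta> S) (\<lambda>y. luce_score \<theta> S y i)
      = pmf (luce_pmf \<theta> S) i - (if i \<in> S then luce_prob \<theta> S i else 0)"
    unfolding luce_score_def
    by (subst Bochner_Integration.integral_diff)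
       (simp_all add: measure_pmf_single set_luce_pmf[OF assms] assms(1) integrable_measure_pmf_finite)
  then show ?thesis by (simp add: pmf_luce_pmf[OF assms])
qed

text \<open>For a choice probability \<open>q\<close>, \<open>(1 - q)\<^sup>2 \<le> 1 + q\<close>
  and \<open>q\<^sup>2 \<le> q\<close>, so the squared norm is at most the sum of two masses, each
  at most 1.\<close>

lemma L2_set_luce_score_le:
  assumes S: "S \<subseteq> {..<n}" "S \<noteq> {}"
  shows "L2_set (luce_score \<theta> S y) {..<n} \<le> sqrt 2"
proof -
  have fin: "finite S" using S finite_subset by blast
  let ?p = "\<lambda>i. if i \<in> S then luce_prob \<theta> S i else 0"
  have sum1: "(\<Sum>i<n. ?p i) = 1"
    using S sum_luce_prob[OF fin S(2), of \<theta>] by (simp add: sum.If_cases Int_absorb1)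
  have p: "0 \<le> ?p i" "?p i \<le> 1" for i
  proof -
    show "0 \<le> ?p i" using luce_prob_pos[OF fin S(2), of \<theta> i] by simp
    show "?p i \<le> 1"
      using member_le_sum[of i S "luce_prob \<theta> S"] luce_prob_pos[OF fin S(2)] fin sum_luce_prob[OF fin S(2)]
      by (auto simp: less_imp_le)
  qed
  have "(\<Sum>i<n. (luce_score \<theta> S y i)\<^sup>2) \<le> (\<Sum>i<n. indicator {i} y + ?p i)"
  proof (rule sum_mono)
    fix i
    define q where "q = ?p i"
    have q: "0 \<le> q" "q * q \<le> q" using p[of i] mult_left_le[of q q] by (auto simp: q_def)
    have "(luce_score \<theta> S y i)\<^sup>2 = (indicator {i} y - q)\<^sup>2"
      by (simp only: luce_score_def q_def)
    also have "\<dots> \<le> indicator {i} y + q"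
      using q by (simp add: indicator_def power2_eq_square algebra_simps)
    finally show "(luce_score \<theta> S y i)\<^sup>2 \<le> indicator {i} y + ?p i" by (simp only: q_def)
  qed
  also have "\<dots> = (\<Sum>i<n. indicator {i} y) + 1" unfolding sum.distrib sum1 ..
  \<comment> \<open>Only an inequality, since \<open>y\<close> may lie outside the items.\<close>
  also have "(\<Sum>i<n. indicator {i} y :: real) \<le> 1"
    using card_mono[of "{y}" "{..<n} \<inter> {y}"] by (simp add: indicator_def)
  finally show ?thesis by (simp add: L2_set_def)
qed

text \<open>The log-likelihood is linear apart from the log-normalisers, to which
  \<open>log_sum_exp_lower_bound\<close> applies; their first-order parts combine with the linear
  terms into the score.\<close>

lemma loglik_increment_le:
  assumes \<theta>: "\<theta> \<in> Theta n b" and \<theta>': "\<theta>' \<in> Theta n b"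
    and sets: "\<And>t. t < m \<Longrightarrow> S t \<subseteq> {..<n} \<and> card (S t) = k" and k: "k > 0"
  defines "\<delta> \<equiv> \<lambda>i. \<theta>' i - \<theta> i"
  shows "loglik m S y \<theta>' - loglik m S y \<theta>
     \<le> (\<Sum>i<n. (\<Sum>t<m. luce_score \<theta> (S t) (y t) i) * \<delta> i)
       - exp (- 4 * b) / (4 * k\<^sup>2) * (\<Sum>t<m. \<Sum>u\<in>S t. \<Sum>v\<in>S t. (\<delta> u - \<delta> v)\<^sup>2)"
proof -
  have step: "ln (luce_prob \<theta>' (S t) (y t)) - ln (luce_prob \<theta> (S t) (y t))
     \<le> (\<Sum>i<n. luce_score \<theta> (S t) (y t) i * \<delta> i)
       - exp (- 4 * b) / (4 * k\<^sup>2) * (\<Sum>u\<in>S t. \<Sum>v\<in>S t. (\<delta> u - \<delta> v)\<^sup>2)" if t: "t < m" for t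
  proof -
    have sub: "S t \<subseteq> {..<n}" and card: "card (S t) = k" using sets[OF t] by auto
    have S: "finite (S t)" "S t \<noteq> {}" using card k card_gt_0_iff[of "S t"] by auto
    have ln: "ln (luce_prob \<eta> (S t) i) = \<eta> i - ln (\<Sum>v\<in>S t. exp (\<eta> v))" for \<eta> i
    proof -
      have "(\<Sum>v\<in>S t. exp (\<eta> v)) > 0" using S by (intro sum_pos) auto
      then show ?thesis by (simp add: luce_prob_def ln_div)
    qed
    \<comment> \<open>Makes the identity \<open>score\<close> hold also when \<open>y t\<close> is
      not an item.\<close>
    have d0: "\<delta> i = 0" if "i \<ge> n" for i using that \<theta> \<theta>' by (auto simp: \<delta>_def Theta_def)
    have "(\<Sum>i<n. luce_score \<theta> (S t) (y t) i * \<delta> i)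
      = (\<Sum>i<n. if i = y t then \<delta> (y t) else 0) - (\<Sum>i<n. if i \<in> S t then luce_prob \<theta> (S t) i * \<delta> i else 0)"
      unfolding sum_subtractf[symmetric]
      by (intro sum.cong) (auto simp: luce_score_def algebra_simps)
    also have "\<dots> = \<delta> (y t) - (\<Sum>i\<in>S t. luce_prob \<theta> (S t) i * \<delta> i)"
      using d0[of "y t"] sub by (simp add: sum.If_cases Int_absorb1)
    finally have score: "(\<Sum>i<n. luce_score \<theta> (S t) (y t) i * \<delta> i)
      = \<delta> (y t) - (\<Sum>i\<in>S t. luce_prob \<theta> (S t) i * \<delta> i)" .
    have "ln (\<Sum>v\<in>S t. exp (\<theta> v + \<delta> v))
     \<ge> ln (\<Sum>v\<in>S t. exp (\<theta> v)) + (\<Sum>v\<in>S t. exp (\<theta> v) / (\<Sum>u\<in>S t. exp (\<theta> u)) * \<delta> v)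
       + exp (- 4 * b) / (4 * (card (S t))\<^sup>2) * (\<Sum>u\<in>S t. \<Sum>v\<in>S t. (\<delta> u - \<delta> v)\<^sup>2)"
      using \<theta> \<theta>' sub by (intro log_sum_exp_lower_bound S) (auto simp: Theta_def \<delta>_def)
    then show ?thesis unfolding score ln card by (simp add: \<delta>_def luce_prob_def)
  qed
  have "loglik m S y \<theta>' - loglik m S y \<theta>
      = (\<Sum>t<m. ln (luce_prob \<theta>' (S t) (y t)) - ln (luce_prob \<theta> (S t) (y t)))"
    by (simp add: loglik_def sum_subtractf)
  also have "\<dots> \<le> (\<Sum>t<m. (\<Sum>i<n. luce_score \<theta> (S t) (y t) i * \<delta> i)
       - exp (- 4 * b) / (4 * k\<^sup>2) * (\<Sum>u\<in>S t. \<Sum>v\<in>S t. (\<delta> u - \<delta> v)\<^sup>2))"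
    by (intro sum_mono step) auto
  also have "\<dots> = (\<Sum>t<m. \<Sum>i<n. luce_score \<theta> (S t) (y t) i * \<delta> i)
       - exp (- 4 * b) / (4 * k\<^sup>2) * (\<Sum>t<m. \<Sum>u\<in>S t. \<Sum>v\<in>S t. (\<delta> u - \<delta> v)\<^sup>2)"
    by (simp only: sum_subtractf sum_distrib_left)
  also have "(\<Sum>t<m. \<Sum>i<n. luce_score \<theta> (S t) (y t) i * \<delta> i)
      = (\<Sum>i<n. (\<Sum>t<m. luce_score \<theta> (S t) (y t) i) * \<delta> i)"
    by (subst sum.swap) (simp add: sum_distrib_right)
  finally show ?thesis .
qed

section \<open>Quadratic form of the co-occurrence Laplacian\<close>

lemma laplacian_quad_form:
  fixes M :: "nat \<Rightarrow> nat \<Rightarrow> real"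
  assumes sym: "\<And>i j. M i j = M j i"
  shows "(\<Sum>i<n. \<Sum>j<n. x i * ((if i = j then (\<Sum>l<n. M i l) else 0) - M i j) * x j)
       = (\<Sum>i<n. \<Sum>j<n. M i j * (x i - x j)\<^sup>2) / 2"
proof -
  have "(\<Sum>i<n. \<Sum>j<n. x i * ((if i = j then (\<Sum>l<n. M i l) else 0) - M i j) * x j)
      = (\<Sum>i<n. \<Sum>j<n. (if j = i then (\<Sum>l<n. M i l) * (x i)\<^sup>2 else 0) - M i j * x i * x j)"
    by (intro sum.cong) (auto simp: algebra_simps power2_eq_square)
  also have "\<dots> = (\<Sum>i<n. \<Sum>j<n. M i j * (x i)\<^sup>2) - (\<Sum>i<n. \<Sum>j<n. M i j * x i * x j)"
    by (simp add: sum_subtractf sum_distrib_right)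
  finally have l: "(\<Sum>i<n. \<Sum>j<n. x i * ((if i = j then (\<Sum>l<n. M i l) else 0) - M i j) * x j) = \<dots>" .
  have "(\<Sum>i<n. \<Sum>j<n. M i j * (x j)\<^sup>2) = (\<Sum>i<n. \<Sum>j<n. M i j * (x i)\<^sup>2)"
    by (subst sum.swap) (simp add: sym)
  moreover have "(\<Sum>i<n. \<Sum>j<n. M i j * (x i - x j)\<^sup>2)
     = (\<Sum>i<n. \<Sum>j<n. M i j * (x i)\<^sup>2) + (\<Sum>i<n. \<Sum>j<n. M i j * (x j)\<^sup>2)
       - 2 * (\<Sum>i<n. \<Sum>j<n. M i j * x i * x j)"
    unfolding sum_distrib_left sum.distrib[symmetric] sum_subtractf[symmetric]
    by (intro sum.cong) (auto simp: power2_eq_square algebra_simps)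
  ultimately show ?thesis unfolding l by simp
qed

text \<open>Double counting: a pair of items is weighted by the number of comparison sets containing
  it, so the Laplacian form splits over these sets. Counting ordered pairs accounts for the factor
  1/2.\<close>

lemma lambda2_laplacian_cooc_le:
  fixes x :: "nat \<Rightarrow> real"
  assumes n: "n \<ge> 2"
    and sets: "\<And>t. t < m \<Longrightarrow> S t \<subseteq> {..<n}"
    and pos: "lambda2 (laplacian (cooc_mat n m S)) > 0"
    and x: "(\<Sum>i<n. x i) = 0"
  shows "lambda2 (laplacian (cooc_mat n m S)) * (\<Sum>i<n. (x i)\<^sup>2)
       \<le> real n / (2 * real m) * (\<Sum>t<m. \<Sum>u\<in>S t. \<Sum>v\<in>S t. (x u - x v)\<^sup>2)"
proof -
  define c where "c = (\<lambda>i j. real (card {t. t < m \<and> {i, j} \<subseteq> S t}))"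
  define M where "M = (\<lambda>i j. if i = j then 0 else real n / real m * c i j)"
  define L where "L = (\<lambda>i j. (if i = j then (\<Sum>l<n. M i l) else 0) - M i j)"
  have cs: "c i j = c j i" for i j unfolding c_def by (simp add: insert_commute)
  have sym: "M i j = M j i" for i j by (simp add: M_def cs)
  have mat: "laplacian (cooc_mat n m S) = mat n n (\<lambda>(i,j). L i j)"
    by (rule eq_matI) (auto simp: laplacian_def cooc_mat_def L_def M_def c_def intro!: sum.cong)
  have "lambda2 (laplacian (cooc_mat n m S)) * (\<Sum>i<n. (x i)\<^sup>2) \<le> (\<Sum>i<n. \<Sum>j<n. x i * L i j * x j)"
    unfolding mat
  proof (rule lambda2_le_quad_form[OF n _ _ _ x])
    show "L i j = L j i" for i j by (simp add: L_def sym)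
    show "(\<Sum>j<n. L i j) = 0" if "i < n" for i using that by (simp add: L_def sum_subtractf)
    show "lambda2 (mat n n (\<lambda>(i,j). L i j)) > 0" using pos unfolding mat .
  qed
  also have "\<dots> = (\<Sum>i<n. \<Sum>j<n. M i j * (x i - x j)\<^sup>2) / 2"
    unfolding L_def by (rule laplacian_quad_form) (rule sym)
  \<comment> \<open>On the diagonal \<open>M\<close> is 0 while \<open>c\<close> need not be, but
    there \<open>x i - x j\<close> vanishes.\<close>
  also have "\<dots> = (\<Sum>i<n. \<Sum>j<n. real n / real m * (c i j * (x i - x j)\<^sup>2)) / 2"
    by (intro arg_cong[where f = "\<lambda>z. z / 2"] sum.cong) (auto simp: M_def)
  also have "\<dots> = real n / (2 * real m) * (\<Sum>i<n. \<Sum>j<n. c i j * (x i - x j)\<^sup>2)"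
    by (simp only: sum_distrib_left[symmetric]) simp
  also have "(\<Sum>i<n. \<Sum>j<n. c i j * (x i - x j)\<^sup>2) = (\<Sum>t<m. \<Sum>u\<in>S t. \<Sum>v\<in>S t. (x u - x v)\<^sup>2)"
  proof -
    let ?g = "\<lambda>t i j. if i \<in> S t then (if j \<in> S t then (x i - x j)\<^sup>2 else 0) else 0"
    have "c i j * (x i - x j)\<^sup>2 = (\<Sum>t<m. ?g t i j)" for i j
    proof -
      have "c i j = (\<Sum>t<m. if {i, j} \<subseteq> S t then 1 else 0)"
        unfolding c_def by (simp add: sum.If_cases Int_def)
      then show ?thesis by (auto simp: sum_distrib_right intro!: sum.cong)
    qed
    then have "(\<Sum>i<n. \<Sum>j<n. c i j * (x i - x j)\<^sup>2) = (\<Sum>i<n. \<Sum>t<m. \<Sum>j<n. ?g t i j)"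
      by (simp add: sum.swap[of _ "{..<m}"])
    also have "\<dots> = (\<Sum>t<m. \<Sum>i<n. \<Sum>j<n. ?g t i j)" by (rule sum.swap)
    also have "\<dots> = (\<Sum>t<m. \<Sum>u\<in>S t. \<Sum>v\<in>S t. (x u - x v)\<^sup>2)"
    proof (rule sum.cong)
      fix t assume "t \<in> {..<m}"
      then have sub: "S t \<subseteq> {..<n}" using sets by simp
      have inner: "(\<Sum>j<n. ?g t i j) = (if i \<in> S t then (\<Sum>v\<in>S t. (x i - x v)\<^sup>2) else 0)" for i
        using sub by (simp add: sum.If_cases Int_absorb1)
      show "(\<Sum>i<n. \<Sum>j<n. ?g t i j) = (\<Sum>u\<in>S t. \<Sum>v\<in>S t. (x u - x v)\<^sup>2)"
        unfolding inner using sub by (simp add: sum.If_cases Int_absorb1)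
    qed simp
    finally show ?thesis .
  qed
  finally show ?thesis .
qed

text \<open>The deterministic half of the argument: nonnegative gain and Cauchy-Schwarz bound the
  quadratic form by a multiple of \<open>g * d\<close>, the eigenvalue bounds it below by a multiple
  of \<open>d\<^sup>2\<close>, and one factor \<open>d\<close> cancels.\<close>

lemma MSE_le_score_norm:
  assumes \<theta>: "\<theta> \<in> Theta n b" and \<theta>h: "\<theta>h \<in> Theta n b"
    and sets: "\<And>t. t < m \<Longrightarrow> S t \<subseteq> {..<n} \<and> card (S t) = k"
    and k: "k > 0" and n: "n \<ge> 2" and m: "m > 0"
    and lam: "lambda2 (laplacian (cooc_mat n m S)) > 0"
    and ge: "loglik m S y \<theta> \<le> loglik m S y \<theta>h"
  shows "MSE n \<theta>h \<theta> \<le> (2 * real k ^ 2 * exp (4 * b))\<^sup>2 * real n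
           / (real m * lambda2 (laplacian (cooc_mat n m S)))\<^sup>2
           * (L2_set (\<lambda>i. \<Sum>t<m. luce_score \<theta> (S t) (y t) i) {..<n})\<^sup>2"
proof -
  let ?lam = "lambda2 (laplacian (cooc_mat n m S))"
  define \<delta> where "\<delta> = (\<lambda>i. \<theta>h i - \<theta> i)"
  define G where "G = (\<lambda>i. \<Sum>t<m. luce_score \<theta> (S t) (y t) i)"
  define d where "d = L2_set \<delta> {..<n}"
  define g where "g = L2_set G {..<n}"
  define W where "W = (\<Sum>t<m. \<Sum>u\<in>S t. \<Sum>v\<in>S t. (\<delta> u - \<delta> v)\<^sup>2)"
  have dg: "d \<ge> 0" "g \<ge> 0" by (auto simp: d_def g_def)
  have d2: "d\<^sup>2 = (\<Sum>i<n. (\<delta> i)\<^sup>2)" by (simp add: d_def L2_set_def sum_nonneg)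
  \<comment> \<open>Chosen so that \<open>1 / (2 * K)\<close> is the curvature constant
    \<open>exp (- 4 * b) / (4 * k\<^sup>2)\<close>.\<close>
  define K where "K = 2 * real k ^ 2 * exp (4 * b)"
  have K: "K > 0" using k by (simp add: K_def)
  have "(\<Sum>i<n. \<delta> i) = 0" using \<theta> \<theta>h by (simp add: \<delta>_def Theta_def sum_subtractf)
  then have "?lam * d\<^sup>2 \<le> real n / (2 * real m) * W"
    unfolding d2 W_def using n lam sets by (intro lambda2_laplacian_cooc_le) auto
  then have W: "2 * real m * ?lam * d\<^sup>2 \<le> real n * W"
    using m by (simp add: field_simps)
  have "0 \<le> loglik m S y \<theta>h - loglik m S y \<theta>" using ge by simp
  also have "\<dots> \<le> (\<Sum>i<n. G i * \<delta> i) - exp (- 4 * b) / (4 * k\<^sup>2) * W"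
    using loglik_increment_le[OF \<theta> \<theta>h sets k, where y = y] by (simp add: G_def W_def \<delta>_def)
  also have "(\<Sum>i<n. G i * \<delta> i) \<le> (\<Sum>i<n. \<bar>G i\<bar> * \<bar>\<delta> i\<bar>)"
    by (intro sum_mono) (simp flip: abs_mult)
  also have "\<dots> \<le> g * d" unfolding g_def d_def by (rule L2_set_mult_ineq)
  finally have "exp (- 4 * b) / (4 * k\<^sup>2) * W \<le> g * d" by simp
  moreover have "exp (- 4 * b) / (4 * k\<^sup>2) = 1 / (2 * K)"
    by (simp add: K_def exp_minus field_simps)
  ultimately have "1 / (2 * K) * W \<le> g * d" by (simp only:)
  then have "W \<le> 2 * K * (g * d)" using K by (simp add: field_simps)
  then have "real n * W \<le> real n * (2 * K * (g * d))" by (intro mult_left_mono) auto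
  with W have main: "(real m * ?lam * d) * d \<le> (K * real n * g) * d"
    by (simp add: power2_eq_square algebra_simps)
  have "real m * ?lam * d \<le> K * real n * g"
  proof (cases "d = 0")
    case True
    then show ?thesis using K dg by simp
  next
    case False
    then show ?thesis using main dg by (simp add: mult_le_cancel_right)
  qed
  then have "(real m * ?lam * d)\<^sup>2 \<le> (K * real n * g)\<^sup>2"
    using dg lam by (intro power_mono) auto
  then have "(real m * ?lam)\<^sup>2 * d\<^sup>2 \<le> K\<^sup>2 * (real n)\<^sup>2 * g\<^sup>2"
    by (simp add: power_mult_distrib)
  then have "d\<^sup>2 \<le> K\<^sup>2 * (real n)\<^sup>2 * g\<^sup>2 / (real m * ?lam)\<^sup>2"
    using m lam by (simp add: pos_le_divide_eq mult.commute)
  then have "1 / real n * d\<^sup>2 \<le> 1 / real n * (K\<^sup>2 * (real n)\<^sup>2 * g\<^sup>2 / (real m * ?lam)\<^sup>2)"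
    by (intro mult_left_mono) auto
  also have "\<dots> = K\<^sup>2 * real n / (real m * ?lam)\<^sup>2 * g\<^sup>2"
    using n by (simp add: power2_eq_square)
  finally show ?thesis unfolding MSE_def K_def g_def G_def d2 \<delta>_def .
qed

theorem theorem2:
  fixes n m k :: nat and b :: real and S :: "nat \<Rightarrow> nat set" and \<theta>s :: "nat \<Rightarrow> real"
  assumes theta_star: "\<theta>s \<in> Theta n b"
    and sets: "\<And>t. t < m \<Longrightarrow> S t \<subseteq> {..<n} \<and> card (S t) = k"
    and k2: "k \<ge> 2"
    and lam: "lambda2 (laplacian (cooc_mat n m S)) > 0"
  shows "measure_pmf.prob (choices_pmf \<theta>s m S)
     {y. \<forall>\<theta>h \<in> Theta n b. (\<forall>\<theta>\<in>Theta n b. loglik m S y \<theta> \<le> loglik m S y \<theta>h) \<longrightarrow>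
          MSE n \<theta>h \<theta>s \<le> (4 * real k ^ 2 * exp (4 * b))\<^sup>2
             * (real n * (ln (real n) + 2) / (lambda2 (laplacian (cooc_mat n m S)))\<^sup>2)
             * (1 / real m)}
     \<ge> 1 - 2 / real n"
proof -
  let ?P = "choices_pmf \<theta>s m S" and ?lam = "lambda2 (laplacian (cooc_mat n m S))"
  let ?good = "{y. \<forall>\<theta>h \<in> Theta n b. (\<forall>\<theta>\<in>Theta n b. loglik m S y \<theta> \<le> loglik m S y \<theta>h) \<longrightarrow>
          MSE n \<theta>h \<theta>s \<le> (4 * real k ^ 2 * exp (4 * b))\<^sup>2
             * (real n * (ln (real n) + 2) / ?lam\<^sup>2) * (1 / real m)}"
  \<comment> \<open>For \<open>n < 2\<close> the root list has no entry 1, so \<open>lambda2\<close>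
    carries no information. For \<open>n = 0\<close> division by zero makes the required probability
    1, but both sides of the error bound are 0; for \<open>n = 1\<close> it is negative.\<close>
  consider "n = 0" | "n = 1" | "n \<ge> 2" by linarith
  then show ?thesis
  proof cases
    case 1
    then have "?good = UNIV" by (simp add: MSE_def)
    then show ?thesis by simp
  next
    case 2
    have "1 - 2 / real n \<le> 0" using 2 by simp
    then show ?thesis by (rule order_trans) simp
  next
    case n: 3
    \<comment> \<open>Without observations the form vanishes, while the difference of two unit
      vectors has positive norm, contradicting \<open>lam\<close>.\<close>
    have m: "m > 0"
    proof (rule ccontr)
      assume "\<not> m > 0"
      then have m0: "m = 0" by simp
      let ?x = "\<lambda>i. (if i = 0 then 1 else 0) - (if i = 1 then 1 else 0 :: real)"
      have "?lam * (\<Sum>i<n. (?x i)\<^sup>2) \<le> real n / (2 * real m) * (\<Sum>t<m. \<Sum>u\<in>S t. \<Sum>v\<in>S t. (?x u - ?x v)\<^sup>2)"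
        using n lam sets by (intro lambda2_laplacian_cooc_le) (auto simp: sum_subtractf)
      then have "?lam * (\<Sum>i<n. (?x i)\<^sup>2) \<le> 0" using m0 by simp
      moreover have "(\<Sum>i<n. (?x i)\<^sup>2) > 0"
        using n by (intro sum_pos2[of _ 0]) auto
      ultimately show False using lam by (simp add: mult_le_0_iff)
    qed
    let ?X = "\<lambda>y. L2_set (\<lambda>i. \<Sum>t<m. luce_score \<theta>s (S t) (y t) i) {..<n}"
    \<comment> \<open>Makes the tail exponent equal to \<open>ln (real n) + 2\<close>, so the tail
      is at most \<open>2 / real n\<close> with a factor \<open>exp (- 2)\<close> to spare. The 4
      under the root turns the constant 2 of \<open>MSE_le_score_norm\<close> into 4.\<close>
    define r where "r = sqrt (4 * real m * (ln (real n) + 2))"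
    have r: "r \<ge> 0" "r\<^sup>2 = 4 * real m * (ln (real n) + 2)" using n by (auto simp: r_def)
    have S: "finite (S t)" "S t \<noteq> {}" if "t < m" for t
      using sets[OF that] k2 card_gt_0_iff[of "S t"] by auto
    have "measure_pmf.prob ?P {y. ?X y \<ge> r} \<le> 2 * exp (- (r\<^sup>2) / (2 * (sqrt 2)\<^sup>2 * card {..<m}))"
      unfolding choices_pmf_def
      using m r sets S
      by (intro prob_L2_set_sum_ge_le L2_set_luce_score_le expectation_luce_score)
         (auto simp: set_luce_pmf)
    also have "- (r\<^sup>2) / (2 * (sqrt 2)\<^sup>2 * card {..<m}) = - (ln (real n) + 2)"
      using m unfolding r(2) by simp
    also have "2 * exp (- (ln (real n) + 2)) \<le> 2 * exp (- ln (real n))" by simp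
    also have "\<dots> = 2 / real n" using n by (simp add: exp_minus divide_inverse)
    finally have tail: "measure_pmf.prob ?P {y. ?X y \<ge> r} \<le> 2 / real n" .
    \<comment> \<open>The score does not depend on the estimator, so one event serves all maximisers
      at once.\<close>
    have "- {y. ?X y \<ge> r} \<subseteq> ?good"
    proof (intro subsetI CollectI ballI impI)
      fix y \<theta>h
      assume y: "y \<in> - {y. ?X y \<ge> r}" and \<theta>h: "\<theta>h \<in> Theta n b"
        and opt: "\<forall>\<theta>\<in>Theta n b. loglik m S y \<theta> \<le> loglik m S y \<theta>h"
      have "(?X y)\<^sup>2 \<le> r\<^sup>2" using y by (intro power_mono) auto
      have "MSE n \<theta>h \<theta>s \<le> (2 * real k ^ 2 * exp (4 * b))\<^sup>2 * real n / (real m * ?lam)\<^sup>2 * (?X y)\<^sup>2"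
        using theta_star \<theta>h sets k2 n m lam opt by (intro MSE_le_score_norm) auto
      also have "\<dots> \<le> (2 * real k ^ 2 * exp (4 * b))\<^sup>2 * real n / (real m * ?lam)\<^sup>2 * r\<^sup>2"
        using \<open>(?X y)\<^sup>2 \<le> r\<^sup>2\<close> by (intro mult_left_mono) auto
      also have "\<dots> = (4 * real k ^ 2 * exp (4 * b))\<^sup>2
             * (real n * (ln (real n) + 2) / ?lam\<^sup>2) * (1 / real m)"
        unfolding r(2) using m by (simp add: power_mult_distrib power2_eq_square mult_ac)
      finally show "MSE n \<theta>h \<theta>s \<le> (4 * real k ^ 2 * exp (4 * b))\<^sup>2
             * (real n * (ln (real n) + 2) / ?lam\<^sup>2) * (1 / real m)" .
    qed
    then have "measure_pmf.prob ?P (- {y. ?X y \<ge> r}) \<le> measure_pmf.prob ?P ?good"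
      by (intro measure_pmf.finite_measure_mono) auto
    moreover have "measure_pmf.prob ?P (- {y. ?X y \<ge> r}) = 1 - measure_pmf.prob ?P {y. ?X y \<ge> r}"
      using measure_pmf.prob_compl[of "{y. ?X y \<ge> r}" ?P] by (simp add: Compl_eq_Diff_UNIV)
    ultimately show ?thesis using tail by linarith
  qed
qed

end
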